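(* Let $n\ge 1$ and let $A=(a_{i,j})_{i,j\in[n]}$ be an $n\times n$ matrix (with entries regarded as commuting variables). Then the Hamiltonian path polynomial satisfies $$P_{HP_n}(A)=\sum_{\substack{i,j\in[n],\ T\subseteq[n]\\ \{i,j\}\subseteq T}}a_{j,j}\,\det\big((-A)_{[n]\setminus T}\big)\,\operatorname{per}\big(A_{T\setminus\{j\},\,T\setminus\{i\}}\big),$$ where the sum runs over all triples $(i,j,T)$ with $(i,j)\in[n]\times[n]$ an ordered pair (the case $i=j$ is included) and $T\subseteq[n]$ a subset containing both $i$ and $j$.
   Context: Notation: $[n]=\{1,2,\dots,n\}$. The graph of a function $f:[n]\to[n]$ is the directed graph $G_f$ on $[n]$ with edge set $\{(i,f(i)):i\in[n]\}$, and its edge monomial is $\prod_{i\in[n]}a_{i,f(i)}$. The symbolic listing of a family $\mathcal F$ of functions $[n]\to[n]$ is $P_{\mathcal F}(A)=\sum_{f\in\mathcal F}\prod_{i\in[n]}a_{i,f(i)}$. The Hamiltonian path polynomial $P_{HP_n}(A)$ is the symbolic listing of the family $HP_n$ of functional Hamiltonian paths on $[n]$, i.e. functions $f:[n]\to[n]$ whose graph $G_f$ consists of a directed path visiting every vertex of $[n]$ exactly once together with a loop at the terminal vertex of the path. Equivalently, there is an ordering $v_1,\dots,v_n$ of $[n]$ with $f(v_k)=v_{k+1}$ for $1\le k<n$ and $f(v_n)=v_n$. For $R\subseteq[n]$, $(-A)_R$ is the principal submatrix of $-A$ with rows and columns indexed by $R$. For $R,C\subseteq[n]$ with $|R|=|C|$,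 $A_{R,C}$ is the submatrix of $A$ with rows indexed by $R$ and columns indexed by $C$, and its permanent is $\operatorname{per}(A_{R,C})=\sum_{f}\prod_{u\in R}a_{u,f(u)}$, the sum being over all bijections $f:R\to C$. The determinant and permanent of the empty matrix are $1$. *)

theory Defs
  imports "HOL-Library.FuncSet" "Jordan_Normal_Form.Determinant" "Jordan_Normal_Form.DL_Submatrix"
begin

text \<open>
  The vertex set $[n]$ is represented by \<open>{0..<n}\<close>, in agreement with the indexing of the
  library matrices; functions $[n] \to [n]$ are the elements of \<open>{0..<n} \<rightarrow>\<^sub>E {0..<n}\<close>, the
  extensional function space, so that each function is counted exactly once.
  Matrix entries range over an arbitrary commutative ring. An identity holding there
  universally holds in particular for a matrix of indeterminates over the integers.
\<close>

definition fun_graph :: "nat \<Rightarrow> (nat \<Rightarrow> nat) \<Rightarrow> (nat \<times> nat) set" where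
  "fun_graph n f = {(i, f i) | i. i \<in> {0..<n}}"

definition edge_monomial :: "nat \<Rightarrow> 'a::comm_ring_1 mat \<Rightarrow> (nat \<Rightarrow> nat) \<Rightarrow> 'a" where
  "edge_monomial n A f = (\<Prod>i\<in>{0..<n}. A $$ (i, f i))"

definition symbolic_listing :: "nat \<Rightarrow> (nat \<Rightarrow> nat) set \<Rightarrow> 'a::comm_ring_1 mat \<Rightarrow> 'a" where
  "symbolic_listing n F A = (\<Sum>f\<in>F. edge_monomial n A f)"

definition path_edges :: "nat list \<Rightarrow> (nat \<times> nat) set" where
  "path_edges vs = {(vs ! k, vs ! Suc k) | k. Suc k < length vs}"

text \<open>The definition is only meaningful for \<open>n \<ge> 1\<close>: \<open>last []\<close> is unspecified.\<close>

definition functional_ham_paths :: "nat \<Rightarrow> (nat \<Rightarrow> nat) set" where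
  "functional_ham_paths n =
     {f \<in> {0..<n} \<rightarrow>\<^sub>E {0..<n}.
        \<exists>vs. distinct vs \<and> set vs = {0..<n} \<and>
             fun_graph n f = path_edges vs \<union> {(last vs, last vs)}}"

definition ham_path_polynomial :: "nat \<Rightarrow> 'a::comm_ring_1 mat \<Rightarrow> 'a" where
  "ham_path_polynomial n A = symbolic_listing n (functional_ham_paths n) A"

text \<open>
  The permanent of the submatrix of \<open>A\<close> with row set \<open>R\<close> and column set \<open>C\<close>; the bijections
  are taken extensional, so that the sum is finite and has one term per bijection.
\<close>

definition submatrix_permanent :: "'a::comm_ring_1 mat \<Rightarrow> nat set \<Rightarrow> nat set \<Rightarrow> 'a" where
  "submatrix_permanent A R C =
     (\<Sum>f\<in>{f \<in> R \<rightarrow>\<^sub>E C. bij_betw f R C}. \<Prod>u\<in>R. A $$ (u, f u))"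

end

theory Submission
  imports Defs "HOL-Combinatorics.Cycles"
begin

text \<open>
  Fix \<open>j\<close> and write \<open>N\<close> for the vertex set. A bijection \<open>g\<close> from \<open>T - {j}\<close> to \<open>T - {i}\<close> is a
  directed path from \<open>i\<close> to \<open>j\<close> together with some disjoint cycles; closing the path by the arc
  \<open>j \<mapsto> i\<close> turns it into a permutation of \<open>T\<close>. The Leibniz expansion of the determinant of
  \<open>-A\<close> on \<open>S = N - T\<close> supplies a permutation of \<open>S\<close>, weighted by \<open>-1\<close> for every cycle. Together
  they form one permutation \<open>f\<close> of \<open>N\<close>, in which \<open>S\<close> is an invariant set avoiding \<open>j\<close> and
  \<open>i = f j\<close> carries no extra information. So the right-hand side is a sum over pairs \<open>(j, f)\<close> of
  the monomial \<open>a\<^sub>j\<^sub>j \<Prod>\<^bsub>u \<noteq> j\<^esub> a\<^bsub>u, f u\<^esub>\<close>, with the signed number of such sets \<open>S\<close> as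
  coefficient (\<open>sum_det_per_expansion\<close>).

  An invariant set avoiding \<open>j\<close> is an arbitrary union of cycles of \<open>f\<close> other than that of \<open>j\<close>.
  If there is such a cycle, adding it to or removing it from \<open>S\<close> reverses the sign and the
  coefficient vanishes; otherwise \<open>f\<close> is a single cycle on \<open>N\<close> and only \<open>S = {}\<close> contributes
  (\<open>sum_cycle_parity_invariant_sets\<close>).

  Finally, redirecting the arc that leaves \<open>j\<close> to a loop is a bijection from full cycles with a
  marked vertex \<open>j\<close> to functional Hamiltonian paths ending in \<open>j\<close> (\<open>bij_betw_redirect\<close>), and it
  carries the surviving monomials to the edge monomials.
\<close>

section \<open>Determinants of principal submatrices\<close>

lemma bij_betw_pick:
  assumes "finite S"
  shows "bij_betw (pick S) {0..<card S} S"
proof -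
  have "inj_on (pick S) {0..<card S}"
    by (intro strict_mono_on_imp_inj_on strict_mono_onI pick_mono) auto
  moreover have "pick S ` {0..<card S} \<subseteq> S"
    by (auto intro: pick_in_set)
  ultimately have "pick S ` {0..<card S} = S"
    using assms by (intro card_subset_eq) (auto simp: card_image)
  with \<open>inj_on _ _\<close> show ?thesis by (simp add: bij_betw_def)
qed

text \<open>
  The submatrix is indexed by \<open>{0..<card S}\<close> through \<open>pick S\<close>. Rows and columns are renumbered in
  the same way, so the permutations in the Leibniz formula get conjugated, which preserves signs.
\<close>

lemma det_principal_submatrix:
  fixes A :: "'a::comm_ring_1 mat"
  assumes A: "A \<in> carrier_mat n n" and S: "S \<subseteq> {0..<n}"
  shows "det (submatrix A S S) =
    (\<Sum>p | p permutes S. of_int (sign p) * (\<Prod>i\<in>S. A $$ (i, p i)))"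
proof -
  define m where "m = card S"
  let ?P = "{0..<m}"
  have fin: "finite S" using S finite_subset by blast
  have bij: "bij_betw (pick S) ?P S" unfolding m_def by (rule bij_betw_pick[OF fin])
  have inj: "inj_on (pick S) ?P" using bij by (simp add: bij_betw_def)
  have inv: "bij_betw (inv_into ?P (pick S)) S ?P" by (rule bij_betw_inv_into[OF bij])
  have eq: "{i. i < n \<and> i \<in> S} = S" using S by auto
  have carr: "submatrix A S S \<in> carrier_mat m m"
    using A by (auto simp: submatrix_def eq m_def)
  have ent: "submatrix A S S $$ (i, j) = A $$ (pick S i, pick S j)" if "i < m" "j < m" for i j
    using that A by (intro submatrix_index) (auto simp: eq m_def)
  have "det (submatrix A S S) =
      (\<Sum>p | p permutes ?P. of_int (sign p) * (\<Prod>i\<in>?P. submatrix A S S $$ (i, p i)))"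
    by (rule det_def'[OF carr])
  also have "\<dots> = (\<Sum>p | p permutes S. of_int (sign p) * (\<Prod>i\<in>S. A $$ (i, p i)))"
  proof (rule sum.reindex_bij_witness
      [where j = "map_permutation ?P (pick S)"
        and i = "map_permutation S (inv_into ?P (pick S))"])
    fix p assume p: "p \<in> {p. p permutes ?P}"
    then have pp: "p permutes ?P" by simp
    show "map_permutation S (inv_into ?P (pick S)) (map_permutation ?P (pick S) p) = p"
      by (rule map_permutation_compose_inv[OF bij pp])
        (use inj in \<open>auto intro: inv_into_f_f\<close>)
    show "map_permutation ?P (pick S) p \<in> {p. p permutes S}"
      using map_permutation_permutes[OF bij pp] by simp
    have "(\<Prod>i\<in>S. A $$ (i, map_permutation ?P (pick S) p i))
        = (\<Prod>i\<in>?P. A $$ (pick S i, map_permutation ?P (pick S) p (pick S i)))"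
      by (rule prod.reindex_bij_betw[OF bij, symmetric])
    also have "\<dots> = (\<Prod>i\<in>?P. submatrix A S S $$ (i, p i))"
    proof (rule prod.cong[OF refl])
      fix i assume i: "i \<in> ?P"
      then have "p i \<in> ?P" using permutes_in_image[OF pp] by blast
      then show "A $$ (pick S i, map_permutation ?P (pick S) p (pick S i))
          = submatrix A S S $$ (i, p i)"
        using i by (simp add: map_permutation_apply[OF inj i] ent)
    qed
    finally show "of_int (sign (map_permutation ?P (pick S) p)) *
        (\<Prod>i\<in>S. A $$ (i, map_permutation ?P (pick S) p i)) =
        of_int (sign p) * (\<Prod>i\<in>?P. submatrix A S S $$ (i, p i))"
      by (simp add: sign_map_permutation[OF inj pp])
  next
    fix q assume q: "q \<in> {p. p permutes S}"
    then have qq: "q permutes S" by simp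
    show "map_permutation ?P (pick S) (map_permutation S (inv_into ?P (pick S)) q) = q"
      by (rule map_permutation_compose_inv[OF inv qq])
        (use bij in \<open>auto simp: bij_betw_def f_inv_into_f\<close>)
    show "map_permutation S (inv_into ?P (pick S)) q \<in> {p. p permutes ?P}"
      using map_permutation_permutes[OF inv qq] by simp
  qed
  finally show ?thesis .
qed


section \<open>The signed count of invariant sets\<close>

lemma sign_cycle_of_list:
  assumes "distinct cs" "cs \<noteq> []"
  shows "sign (cycle_of_list cs) = (- 1) ^ (length cs - 1)"
  using assms
proof (induction cs rule: cycle_of_list.induct)
  case (1 i j cs)
  then show ?case
    using sign_compose[OF permutation_swap_id[of i j] permutation_of_cycle[of "j # cs"]]
    by (simp add: sign_swap_id comp_def)
qed auto

text \<open>
  If \<open>f\<close> permutes the finite set \<open>S\<close>, this is \<open>-1\<close> to the power of the number of cycles of \<open>f\<close>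
  on \<open>S\<close>, fixed points included: a cycle of length \<open>l\<close> contributes \<open>(- 1) ^ l\<close> from the
  cardinality and \<open>(- 1) ^ (l - 1)\<close> from the sign. In this form it is the coefficient in the
  Leibniz expansion of the determinant of \<open>-A\<close>.
\<close>

definition cycle_parity :: "('b \<Rightarrow> 'b) \<Rightarrow> 'b set \<Rightarrow> int" where
  "cycle_parity f S = (- 1) ^ card S * sign_on S f"

lemma cycle_parity_empty [simp]: "cycle_parity f {} = 1"
  by (simp add: cycle_parity_def sign_on_def restrict_id_def)

lemma cycle_parity_union:
  assumes fin: "finite S" "finite T" and disj: "S \<inter> T = {}"
    and bij: "bij_betw f S S" "bij_betw f T T"
  shows "cycle_parity f (S \<union> T) = cycle_parity f S * cycle_parity f T"
proof -
  have "restrict_id f (S \<union> T) = restrict_id f S \<circ> restrict_id f T"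
    using disj bij by (auto simp: fun_eq_iff restrict_id_def bij_betw_def)
  moreover have "permutation (restrict_id f S)" "permutation (restrict_id f T)"
    using fin bij by (auto intro: permutes_imp_permutation permutes_restrict_id)
  ultimately have "sign_on (S \<union> T) f = sign_on S f * sign_on T f"
    by (simp add: sign_on_def sign_compose)
  with fin disj show ?thesis
    by (simp add: cycle_parity_def card_Un_disjoint power_add)
qed

lemma mem_support:
  assumes "permutation f"
  shows "x \<in> set (support f x)"
  using least_power_of_permutation(2)[OF assms, of x] by force

lemma image_support:
  assumes "permutation f"
  shows "f ` set (support f x) = set (support f x)"
proof (rule card_subset_eq)
  show "f ` set (support f x) \<subseteq> set (support f x)"
  proof
    fix y assume "y \<in> f ` set (support f x)"
    then obtain k where "y = f ((f ^^ k) x)" by auto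
    then have "y = (f ^^ Suc k) x" by simp
    then show "y \<in> set (support f x)" unfolding support_set[OF assms] by blast
  qed
  have "inj f" using assms by (simp add: permutation bij_is_inj)
  then show "card (f ` set (support f x)) = card (set (support f x))"
    by (meson card_image inj_on_subset subset_UNIV)
qed simp

lemma support_subset:
  assumes "permutation f" "f ` S = S" "x \<in> S"
  shows "set (support f x) \<subseteq> S"
proof -
  have "(f ^^ k) x \<in> S" for k
    using assms(2,3) by (induction k) auto
  then show ?thesis unfolding support_set[OF assms(1)] by blast
qed

lemma cycle_parity_support:
  assumes "permutation f"
  shows "cycle_parity f (set (support f x)) = - 1"
proof -
  let ?cs = "support f x"
  have dist: "distinct ?cs" by (rule cycle_of_permutation[OF assms])
  have ne: "?cs \<noteq> []" using mem_support[OF assms, of x] by auto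
  have "restrict_id f (set ?cs) = cycle_of_list ?cs"
  proof
    fix y show "restrict_id f (set ?cs) y = cycle_of_list ?cs y"
    proof (cases "y \<in> set ?cs")
      case True
      then show ?thesis using cycle_restrict[OF assms True] by simp
    next
      case False
      then show ?thesis by (metis id_outside_supp restrict_id_simps(2))
    qed
  qed
  then have "sign_on (set ?cs) f = (- 1) ^ (length ?cs - 1)"
    unfolding sign_on_def using sign_cycle_of_list[OF dist ne] by simp
  moreover have "card (set ?cs) = Suc (length ?cs - 1)"
    using distinct_card[OF dist] ne by simp
  ultimately show ?thesis
    by (simp only: cycle_parity_def) (simp flip: power_add mult_2)
qed

text \<open>
  For a nonempty \<open>N\<close>, the permutations with a single orbit on \<open>N\<close>, expressed by the absence of
  proper invariant sets: this is the form in which they arise from the cancellation below.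
\<close>

definition full_cycles :: "'b set \<Rightarrow> ('b \<Rightarrow> 'b) set" where
  "full_cycles N = {f. f permutes N \<and> (\<forall>S \<subseteq> N. f ` S = S \<longrightarrow> S = {} \<or> S = N)}"

lemma full_cycles_permutes: "f \<in> full_cycles N \<Longrightarrow> f permutes N"
  by (simp add: full_cycles_def)

lemma full_cyclesD:
  assumes "f \<in> full_cycles N" "S \<subseteq> N" "f ` S = S"
  shows "S = {} \<or> S = N"
  using assms unfolding full_cycles_def by blast

text \<open>
  If \<open>f\<close> is not a full cycle, some cycle \<open>C\<close> of \<open>f\<close> avoids \<open>j\<close>. Every invariant set contains
  \<open>C\<close> or is disjoint from it, and \<open>S \<mapsto> S \<union> C\<close> pairs the two kinds with opposite parity.
\<close>

lemma sum_cycle_parity_invariant_sets: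
  assumes fin: "finite N" and f: "f permutes N" and j: "j \<in> N"
  shows "(\<Sum>S | S \<subseteq> N \<and> j \<notin> S \<and> f ` S = S. cycle_parity f S) =
    (if f \<in> full_cycles N then 1 else 0)"
proof (cases "f \<in> full_cycles N")
  case True
  then have "{S. S \<subseteq> N \<and> j \<notin> S \<and> f ` S = S} = {{}}"
    using j by (auto simp: full_cycles_def)
  with True show ?thesis by simp
next
  case False
  have perm: "permutation f" using fin f permutes_imp_permutation by blast
  have inj: "inj f" using f by (rule permutes_inj)
  have bij: "bij_betw f S S" if "f ` S = S" for S
    using that inj_on_subset[OF inj subset_UNIV] by (simp add: bij_betw_def)
  obtain R where R: "R \<subseteq> N" "f ` R = R" "R \<noteq> {}" "R \<noteq> N"
    using False f by (auto simp: full_cycles_def)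
  \<comment> \<open>an invariant set or its complement misses \<open>j\<close>\<close>
  obtain Q where Q: "Q \<subseteq> N" "f ` Q = Q" "Q \<noteq> {}" "j \<notin> Q"
  proof (cases "j \<in> R")
    case True
    have "f ` (N - R) = N - R"
      using inj R permutes_image[OF f] by (simp add: image_set_diff)
    with R True show ?thesis by (intro that[of "N - R"]) auto
  next
    case False
    with R show ?thesis by (intro that[of R]) auto
  qed
  obtain k where k: "k \<in> Q" using Q by blast
  define C where "C = set (support f k)"
  have C: "f ` C = C" "k \<in> C" "C \<subseteq> Q" "cycle_parity f C = - 1" "finite C"
    using image_support[OF perm] mem_support[OF perm] support_subset[OF perm Q(2) k]
      cycle_parity_support[OF perm] by (auto simp: C_def)
  have sub: "C \<subseteq> S" if "f ` S = S" "k \<in> S" for S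
    using support_subset[OF perm that] by (simp add: C_def)
  have disj: "S \<inter> C = {}" if "f ` S = S" "k \<notin> S" for S
  proof -
    have "f ` (C - S) = C - S" using inj C that by (simp add: image_set_diff)
    then have "C \<subseteq> C - S" using sub C that by blast
    then show ?thesis by blast
  qed
  let ?I = "{S. S \<subseteq> N \<and> j \<notin> S \<and> f ` S = S}"
  let ?Out = "{S \<in> ?I. k \<notin> S}" and ?In = "{S \<in> ?I. k \<in> S}"
  have "sum (cycle_parity f) ?In = sum (\<lambda>S. - cycle_parity f S) ?Out"
  proof (rule sum.reindex_bij_witness[where i = "\<lambda>S. S \<union> C" and j = "\<lambda>S. S - C"])
    fix S assume S: "S \<in> ?In"
    then have CS: "C \<subseteq> S" using sub by blast
    then show "S - C \<union> C = S" by blast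
    have inv: "f ` (S - C) = S - C" using inj C S by (simp add: image_set_diff)
    then show "S - C \<in> ?Out" using S C by auto
    have "finite S" using S fin finite_subset by blast
    then have "cycle_parity f (S - C \<union> C) = cycle_parity f (S - C) * cycle_parity f C"
      using inv C by (intro cycle_parity_union bij) auto
    then show "- cycle_parity f (S - C) = cycle_parity f S"
      using C CS by (simp add: Un_absorb2)
  next
    fix S assume S: "S \<in> ?Out"
    then have "S \<inter> C = {}" using disj by blast
    then show "S \<union> C - C = S" by blast
    show "S \<union> C \<in> ?In" using S C Q by (auto simp: image_Un)
  qed
  moreover have "sum (cycle_parity f) ?I = sum (cycle_parity f) ?Out + sum (cycle_parity f) ?In"
  proof -
    have "?I = ?Out \<union> ?In" by blast
    moreover have "finite ?Out" "finite ?In"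
      using fin by (auto intro: finite_subset[of _ "Pow N"])
    moreover have "?Out \<inter> ?In = {}" by blast
    ultimately show ?thesis by (metis (no_types, lifting) sum.union_disjoint)
  qed
  ultimately show ?thesis using False by (simp add: sum_negf)
qed


section \<open>Hamiltonian paths as full cycles with a marked vertex\<close>

lemma fun_graph_eq_path_iff:
  assumes "distinct vs" "set vs = {0..<n}" "vs \<noteq> []"
  shows "fun_graph n f = path_edges vs \<union> {(last vs, last vs)} \<longleftrightarrow>
    (\<forall>k. Suc k < length vs \<longrightarrow> f (vs ! k) = vs ! Suc k) \<and> f (last vs) = last vs"
    (is "?L \<longleftrightarrow> ?R")
proof
  assume L: ?L
  have f: "f u = v" if "(u, v) \<in> path_edges vs \<union> {(last vs, last vs)}" for u v
    using that unfolding L[symmetric] by (auto simp: fun_graph_def)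
  then show ?R by (auto simp: path_edges_def)
next
  assume R: ?R
  have "(u, f u) \<in> path_edges vs \<union> {(last vs, last vs)}" if u: "u \<in> {0..<n}" for u
  proof -
    obtain k where k: "k < length vs" "u = vs ! k"
      using u assms(2) by (metis in_set_conv_nth)
    show ?thesis
    proof (cases "Suc k < length vs")
      case True
      then show ?thesis using R k by (auto simp: path_edges_def)
    next
      case False
      then have "u = last vs" using k assms(3) by (auto simp: last_conv_nth intro: arg_cong)
      then show ?thesis using R by simp
    qed
  qed
  moreover have "u \<in> {0..<n} \<and> v = f u" if "(u, v) \<in> path_edges vs \<union> {(last vs, last vs)}" for u v
    using that R assms(2,3) by (auto simp: path_edges_def simp flip: assms(2))
  ultimately show ?L by (fastforce simp: fun_graph_def)
qed

text \<open>
  Iterating the cycle rotates the list, so an invariant set containing one entry contains all.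
\<close>

lemma cycle_of_list_full_cycle:
  assumes dist: "distinct vs"
  shows "cycle_of_list vs \<in> full_cycles (set vs)"
proof -
  let ?f = "cycle_of_list vs"
  have "S = set vs" if S: "S \<subseteq> set vs" "?f ` S = S" "S \<noteq> {}" for S
  proof -
    obtain x where x: "x \<in> S" using S by blast
    then obtain k where k: "k < length vs" "x = vs ! k"
      using S by (metis in_set_conv_nth subsetD)
    have inv: "(?f ^^ m) x \<in> S" for m
      using x S(2) by (induction m) auto
    have "vs ! l \<in> S" if l: "l < length vs" for l
    proof -
      let ?m = "length vs - k + l"
      have "(?f ^^ ?m) x = map (?f ^^ ?m) vs ! k" using k by simp
      also have "\<dots> = rotate ?m vs ! k" by (simp add: cyclic_rotation[OF dist])
      also have "\<dots> = vs ! l" using k l by (simp add: nth_rotate)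
      finally show ?thesis using inv[of ?m] by simp
    qed
    then show ?thesis using S(1) by (metis in_set_conv_nth subsetI subset_antisym)
  qed
  then show ?thesis using cycle_permutes[of vs] by (auto simp: full_cycles_def)
qed

lemma full_cycle_no_fixpoint:
  assumes "f \<in> full_cycles N" "x \<in> N" "f x = x"
  shows "N = {x}"
  using full_cyclesD[OF assms(1), of "{x}"] assms(2,3) by simp

text \<open>
  The marked vertex \<open>j\<close> is recovered as the only fixed point of the redirected function. (For
  \<open>n = 1\<close> the full cycle itself has a fixed point, but then there is only one choice of \<open>j\<close>.)
  The value \<open>p j\<close> that the redirection erases is recovered as the only one missing from the image
  of the remaining vertices. The Hamiltonian path is \<open>p j, p (p j), \<dots>, j\<close>.
\<close>

lemma bij_betw_redirect:
  assumes n: "n \<ge> 1"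
  shows "bij_betw (\<lambda>(j, p). restrict (p(j := j)) {0..<n})
    ({0..<n} \<times> full_cycles {0..<n}) (functional_ham_paths n)"
    (is "bij_betw ?h (?N \<times> ?C) _")
  unfolding bij_betw_def
proof (intro conjI subset_antisym)
  show "inj_on ?h (?N \<times> ?C)"
  proof (rule inj_onI, clarify)
    fix j p j' p'
    assume j: "j \<in> ?N" "j' \<in> ?N" and C: "p \<in> ?C" "p' \<in> ?C"
      and eq: "restrict (p(j := j)) ?N = restrict (p'(j' := j')) ?N"
    have at: "(p(j := j)) u = (p'(j' := j')) u" if "u \<in> ?N" for u
      using fun_cong[OF eq, of u] that by simp
    have jj: "j = j'"
    proof (rule ccontr)
      assume ne: "j \<noteq> j'"
      then have "p' j = j" using at[OF j(1)] by simp
      then have "?N = {j}" by (rule full_cycle_no_fixpoint[OF C(2) j(1)])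
      then show False using ne j(2) by (metis singletonD)
    qed
    have perm: "p permutes ?N" "p' permutes ?N" using C by (simp_all add: full_cycles_permutes)
    have off: "p u = p' u" if "u \<noteq> j" for u
      using that at[of u] jj perm by (cases "u \<in> ?N") (simp_all add: permutes_not_in[where S = ?N])
    have im: "q ` (?N - {j}) = ?N - {q j}" if "q permutes ?N" for q
      using permutes_image[OF that] permutes_inj[OF that] by (simp add: image_set_diff)
    have "?N - {p j} = ?N - {p' j}"
    proof -
      have "p ` (?N - {j}) = p' ` (?N - {j})"
        by (rule image_cong[OF refl]) (simp add: off)
      then show ?thesis using im[OF perm(1)] im[OF perm(2)] by simp
    qed
    moreover have "p j \<in> ?N" "p' j \<in> ?N"
      using j permutes_in_image[OF perm(1)] permutes_in_image[OF perm(2)] by auto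
    ultimately have "p j = p' j" by blast
    with off have "p = p'" by (intro ext) metis
    with jj show "j = j' \<and> p = p'" by simp
  qed
  show "?h ` (?N \<times> ?C) \<subseteq> functional_ham_paths n"
  proof (clarify)
    fix j p assume j: "j \<in> ?N" and C: "p \<in> ?C"
    let ?f = "restrict (p(j := j)) ?N"
    have p: "p permutes ?N" using C by (simp add: full_cycles_def)
    have perm: "permutation p" using p permutes_imp_permutation by blast
    define vs where "vs = support p (p j)"
    define L where "L = least_power p (p j)"
    have len: "length vs = L" by (simp add: vs_def L_def)
    have L: "L > 0" using least_power_of_permutation(2)[OF perm] by (simp add: L_def)
    then have ne: "vs \<noteq> []" using len by auto
    have dist: "distinct vs" unfolding vs_def by (rule cycle_of_permutation[OF perm])
    have pj: "p j \<in> ?N" using j permutes_in_image[OF p] by simp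
    have "set vs \<subseteq> ?N"
      unfolding vs_def by (rule support_subset[OF perm permutes_image[OF p] pj])
    moreover have "p ` set vs = set vs" unfolding vs_def by (rule image_support[OF perm])
    ultimately have set: "set vs = ?N" using full_cyclesD[OF C, of "set vs"] ne by simp
    have nth: "vs ! k = (p ^^ k) (p j)" if "k < L" for k
      using that by (simp add: vs_def L_def)
    have "p ((p ^^ L) j) = p j"
      using least_power_of_permutation(1)[OF perm, of "p j"] by (simp add: L_def funpow_swap1)
    then have "(p ^^ L) j = j" by (rule injD[OF permutes_inj[OF p]])
    moreover have "last vs = (p ^^ (L - 1)) (p j)"
      using ne L len nth by (simp add: last_conv_nth)
    ultimately have last: "last vs = j"
      using L funpow_Suc_right[of "L - 1" p] by simp
    have step: "?f (vs ! k) = vs ! Suc k" if k: "Suc k < length vs" for k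
    proof -
      have "vs ! k \<noteq> last vs"
        using k dist ne by (simp add: last_conv_nth nth_eq_iff_index_eq)
      moreover have "vs ! k \<in> ?N" using nth_mem[OF Suc_lessD[OF k]] set by simp
      moreover have "p (vs ! k) = vs ! Suc k" using k nth len by simp
      ultimately show ?thesis using last by simp
    qed
    have "fun_graph n ?f = path_edges vs \<union> {(last vs, last vs)}"
      using step last j by (subst fun_graph_eq_path_iff[OF dist set ne]) simp
    moreover have "?f \<in> ?N \<rightarrow>\<^sub>E ?N"
      using j permutes_in_image[OF p] by auto
    ultimately show "?f \<in> functional_ham_paths n"
      using dist set unfolding functional_ham_paths_def by blast
  qed
  show "functional_ham_paths n \<subseteq> ?h ` (?N \<times> ?C)"
  proof
    fix f assume "f \<in> functional_ham_paths n"
    then obtain vs where f: "f \<in> ?N \<rightarrow>\<^sub>E ?N" and dist: "distinct vs" and set: "set vs = ?N"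
      and graph: "fun_graph n f = path_edges vs \<union> {(last vs, last vs)}"
      unfolding functional_ham_paths_def by blast
    have ne: "vs \<noteq> []" using set n by auto
    have step: "f (vs ! k) = vs ! Suc k" if "Suc k < length vs" for k
      using graph that unfolding fun_graph_eq_path_iff[OF dist set ne] by blast
    have last: "f (last vs) = last vs"
      using graph unfolding fun_graph_eq_path_iff[OF dist set ne] by blast
    let ?p = "cycle_of_list vs"
    have rot: "map ?p vs = rotate1 vs"
      using cyclic_rotation[OF dist, of 1] by simp
    have "f u = restrict (?p(last vs := last vs)) ?N u" for u
    proof (cases "u \<in> ?N")
      case True
      then obtain k where k: "k < length vs" "u = vs ! k"
        using set by (metis in_set_conv_nth)
      show ?thesis
      proof (cases "u = last vs")
        case True
        then show ?thesis using last \<open>u \<in> ?N\<close> by simp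
      next
        case False
        then have "k \<noteq> length vs - 1" using k ne by (auto simp: last_conv_nth)
        then have Suc: "Suc k < length vs" using k by linarith
        have "?p u = map ?p vs ! k" using k by simp
        also have "\<dots> = vs ! Suc k" unfolding rot using Suc by (simp add: nth_rotate1)
        finally show ?thesis using step[OF Suc] k False \<open>u \<in> ?N\<close> by simp
      qed
    next
      case False
      then show ?thesis using f by (simp add: PiE_def extensional_def)
    qed
    then have "f = ?h (last vs, ?p)" by auto
    moreover have "(last vs, ?p) \<in> ?N \<times> ?C"
      using cycle_of_list_full_cycle[OF dist] set last_in_set[OF ne] by auto
    ultimately show "f \<in> ?h ` (?N \<times> ?C)" by blast
  qed
qed

lemma ham_path_polynomial_full_cycles:
  fixes A :: "'a::comm_ring_1 mat"
  assumes n: "n \<ge> 1"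
  shows "ham_path_polynomial n A =
    (\<Sum>(j, p) \<in> {0..<n} \<times> full_cycles {0..<n}.
       A $$ (j, j) * (\<Prod>u\<in>{0..<n} - {j}. A $$ (u, p u)))"
proof -
  let ?h = "\<lambda>(j, p). restrict (p(j := j)) {0..<n}"
  have "ham_path_polynomial n A =
      (\<Sum>x \<in> {0..<n} \<times> full_cycles {0..<n}. edge_monomial n A (?h x))"
    unfolding ham_path_polynomial_def symbolic_listing_def
    by (rule sum.reindex_bij_betw[OF bij_betw_redirect[OF n], symmetric])
  also have "\<dots> = (\<Sum>(j, p) \<in> {0..<n} \<times> full_cycles {0..<n}.
       A $$ (j, j) * (\<Prod>u\<in>{0..<n} - {j}. A $$ (u, p u)))"
  proof (rule sum.cong[OF refl], clarify)
    fix j p assume j: "j \<in> {0..<n}"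
    show "edge_monomial n A (restrict (p(j := j)) {0..<n}) =
        A $$ (j, j) * (\<Prod>u\<in>{0..<n} - {j}. A $$ (u, p u))"
      unfolding edge_monomial_def
      by (subst prod.remove[OF _ j]) (use j in \<open>auto intro!: prod.cong\<close>)
  qed
  finally show ?thesis .
qed


section \<open>Expanding the right-hand side\<close>

text \<open>
  The permutation \<open>p\<close> of the complement of \<open>T\<close>, the bijection \<open>g\<close> from \<open>T - {j}\<close> to
  \<open>T - {i}\<close> and the closing arc \<open>j \<mapsto> i\<close>, merged into one permutation.
\<close>

definition glue :: "nat \<Rightarrow> nat \<Rightarrow> nat set \<Rightarrow> (nat \<Rightarrow> nat) \<Rightarrow> (nat \<Rightarrow> nat) \<Rightarrow> nat \<Rightarrow> nat" where
  "glue i j T p g = (\<lambda>u. if u = j then i else if u \<in> T then g u else p u)"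

lemma glue:
  assumes ij: "i \<in> T" "j \<in> T" and T: "T \<subseteq> N" and p: "p permutes N - T"
    and g: "bij_betw g (T - {j}) (T - {i})"
  shows glue_permutes: "glue i j T p g permutes N"
    and glue_image: "glue i j T p g ` (N - T) = N - T"
    and glue_restrict_id: "restrict_id (glue i j T p g) (N - T) = p"
proof -
  let ?f = "glue i j T p g"
  have fp: "?f u = p u" if "u \<notin> T" for u
    using that ij by (auto simp: glue_def)
  have "bij_betw ?f {j} {i}" by (simp add: glue_def)
  moreover have "bij_betw ?f (T - {j}) (T - {i})"
    using g by (rule bij_betw_cong[THEN iffD1, rotated]) (auto simp: glue_def)
  ultimately have "bij_betw ?f ({j} \<union> (T - {j})) ({i} \<union> (T - {i}))"
    by (rule bij_betw_combine) auto
  then have bT: "bij_betw ?f T T"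
    using ij by (simp add: insert_absorb)
  have bS: "bij_betw ?f (N - T) (N - T)"
    using permutes_imp_bij[OF p] by (rule bij_betw_cong[THEN iffD1, rotated]) (auto simp: fp)
  have "bij_betw ?f (T \<union> (N - T)) (T \<union> (N - T))"
    using bT bS by (rule bij_betw_combine) auto
  moreover have "T \<union> (N - T) = N" using T by blast
  ultimately show "?f permutes N"
  proof (intro bij_imp_permutes)
    fix x assume "x \<notin> N"
    then show "?f x = x" using fp[of x] p T by (auto simp: permutes_not_in)
  qed simp
  show "?f ` (N - T) = N - T" using bS by (simp add: bij_betw_def)
  show "restrict_id ?f (N - T) = p"
  proof
    fix u show "restrict_id ?f (N - T) u = p u"
      using fp[of u] p by (cases "u \<in> N - T") (auto simp: permutes_not_in)
  qed
qed

lemma unglue: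
  assumes f: "f permutes N" and S: "S \<subseteq> N" "f ` S = S" and j: "j \<in> N - S"
  shows unglue_fst: "restrict_id f S permutes S"
    and unglue_snd: "bij_betw (restrict f (N - S - {j})) (N - S - {j}) (N - S - {f j})"
    and unglue_mem: "f j \<in> N - S"
    and unglue_glue:
      "glue (f j) j (N - S) (restrict_id f S) (restrict f (N - S - {j})) = f"
proof -
  have inj: "inj f" using f by (rule permutes_inj)
  have bij: "bij_betw f R (f ` R)" for R
    using inj_on_subset[OF inj subset_UNIV] by (simp add: bij_betw_def)
  have "bij_betw f S S" using bij[of S] S by simp
  then show "restrict_id f S permutes S" by (rule permutes_restrict_id)
  have im: "f ` (N - S) = N - S"
    using S permutes_image[OF f] inj by (simp add: image_set_diff)
  then show "f j \<in> N - S" using j by blast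
  have "f ` (N - S - {j}) = N - S - {f j}"
    using im inj by (simp add: image_set_diff[of f "N - S" "{j}"])
  then have "bij_betw f (N - S - {j}) (N - S - {f j})" using bij by metis
  then show "bij_betw (restrict f (N - S - {j})) (N - S - {j}) (N - S - {f j})"
    by (rule bij_betw_cong[THEN iffD1, rotated]) auto
  show "glue (f j) j (N - S) (restrict_id f S) (restrict f (N - S - {j})) = f"
    using f by (auto simp: glue_def fun_eq_iff restrict_id_def permutes_not_in)
qed

text \<open>
  Expanding determinant and permanent gives a sum over \<open>((i, j, T), p, g)\<close>, and gluing is a
  bijection from these data to the triples \<open>((j, f), S)\<close> with \<open>S = N - T\<close> invariant under the
  permutation \<open>f\<close> and \<open>j \<notin> S\<close>.
\<close>

lemma sum_det_per_expansion:
  fixes A :: "'a::comm_ring_1 mat"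
  assumes A: "A \<in> carrier_mat n n"
  defines "N \<equiv> {0..<n}"
  shows "(\<Sum>(i, j, T) \<in> {(i, j, T). i \<in> N \<and> j \<in> N \<and> T \<subseteq> N \<and> {i, j} \<subseteq> T}.
       A $$ (j, j) * det (submatrix (- A) (N - T) (N - T))
         * submatrix_permanent A (T - {j}) (T - {i})) =
    (\<Sum>(j, f) \<in> N \<times> {f. f permutes N}.
       A $$ (j, j) * (\<Prod>u\<in>N - {j}. A $$ (u, f u)) *
       of_int (\<Sum>S | S \<subseteq> N \<and> j \<notin> S \<and> f ` S = S. cycle_parity f S))"
proof -
  have fin: "finite N" by (simp add: N_def)
  define X where "X = {(i, j, T). i \<in> N \<and> j \<in> N \<and> T \<subseteq> N \<and> {i, j} \<subseteq> T}"
  define P where "P = (\<lambda>(i::nat, j::nat, T). {p. p permutes (N - T)})"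
  define G where "G = (\<lambda>(i::nat, j::nat, T). {g :: nat \<Rightarrow> nat. g \<in> (T - {j}) \<rightarrow>\<^sub>E (T - {i}) \<and> bij_betw g (T - {j}) (T - {i})})"
  define Y where "Y = N \<times> {f. f permutes N}"
  define I where "I = (\<lambda>(j, f). {S. S \<subseteq> N \<and> j \<notin> S \<and> f ` S = S})"
  define W where "W = (\<lambda>((i::nat, j, T), p, g). A $$ (j, j) *
      (of_int (sign p) * (- 1) ^ card (N - T) * (\<Prod>u\<in>N - T. A $$ (u, p u))) *
      (\<Prod>u\<in>T - {j}. A $$ (u, g u)))"
  define V where "V = (\<lambda>((j, f), S).
      A $$ (j, j) * (\<Prod>u\<in>N - {j}. A $$ (u, f u)) * of_int (cycle_parity f S))"
  have "X \<subseteq> N \<times> N \<times> Pow N" by (auto simp: X_def)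
  then have finX: "finite X" using fin by (meson finite_Pow_iff finite_SigmaI finite_subset)
  have finP: "finite (P x)" if "x \<in> X" for x
    using fin by (auto simp: P_def intro: finite_permutations split: prod.split)
  have finG: "finite (G x)" if "x \<in> X" for x
  proof -
    obtain i j T where x: "x = (i, j, T)" by (cases x)
    have "finite T" using that fin by (auto simp: X_def x intro: finite_subset)
    then have "finite ((T - {j}) \<rightarrow>\<^sub>E (T - {i}))" by (intro finite_PiE) auto
    then show ?thesis by (simp add: G_def x)
  qed
  have finY: "finite Y" using fin by (auto simp: Y_def intro: finite_permutations)
  have finI: "finite (I y)" for y
    using fin by (auto simp: I_def split: prod.split)
  have term1: "A $$ (j, j) * det (submatrix (- A) (N - T) (N - T))
      * submatrix_permanent A (T - {j}) (T - {i}) =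
      (\<Sum>y\<in>P (i, j, T) \<times> G (i, j, T). W ((i, j, T), y))" for i j T
  proof -
    have "det (submatrix (- A) (N - T) (N - T)) =
      (\<Sum>p\<in>P (i, j, T). of_int (sign p) * (\<Prod>u\<in>N - T. (- A) $$ (u, p u)))"
      using A unfolding P_def by (simp add: N_def det_principal_submatrix[where n = n])
    also have "\<dots> = (\<Sum>p\<in>P (i, j, T).
        of_int (sign p) * (- 1) ^ card (N - T) * (\<Prod>u\<in>N - T. A $$ (u, p u)))"
    proof (rule sum.cong[OF refl])
      fix p assume "p \<in> P (i, j, T)"
      then have p: "p permutes (N - T)" by (simp add: P_def)
      have "(\<Prod>u\<in>N - T. (- A) $$ (u, p u)) = (\<Prod>u\<in>N - T. - (A $$ (u, p u)))"
      proof (rule prod.cong[OF refl])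
        fix u assume u: "u \<in> N - T"
        then have "p u \<in> N - T" using permutes_in_image[OF p] by blast
        with u A show "(- A) $$ (u, p u) = - (A $$ (u, p u))" by (auto simp: N_def)
      qed
      also have "\<dots> = (- 1) ^ card (N - T) * (\<Prod>u\<in>N - T. A $$ (u, p u))"
        by (rule prod_uminus)
      finally show "of_int (sign p) * (\<Prod>u\<in>N - T. (- A) $$ (u, p u)) =
          of_int (sign p) * (- 1) ^ card (N - T) * (\<Prod>u\<in>N - T. A $$ (u, p u))"
        by (simp add: mult.assoc)
    qed
    finally have det: "det (submatrix (- A) (N - T) (N - T)) = \<dots>" .
    have per: "submatrix_permanent A (T - {j}) (T - {i}) =
        (\<Sum>g\<in>G (i, j, T). \<Prod>u\<in>T - {j}. A $$ (u, g u))"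
      by (simp add: submatrix_permanent_def G_def)
    show ?thesis
      unfolding det per mult.assoc[of "A $$ (j, j)"] sum_product sum.cartesian_product
      by (simp add: W_def sum_distrib_left mult.assoc split_def)
  qed
  have "(\<Sum>(i, j, T) \<in> X. A $$ (j, j) * det (submatrix (- A) (N - T) (N - T))
         * submatrix_permanent A (T - {j}) (T - {i})) =
      (\<Sum>x\<in>X. \<Sum>y\<in>P x \<times> G x. W (x, y))"
    by (rule sum.cong[OF refl]) (use term1 in auto)
  also have "\<dots> = (\<Sum>z \<in> (SIGMA x:X. P x \<times> G x). W z)"
    by (subst sum.Sigma) (use finX finP finG in auto)
  also have "\<dots> = (\<Sum>z \<in> Sigma Y I. V z)"
  proof (rule sum.reindex_bij_witness
      [where j = "\<lambda>((i, j, T), p, g). ((j, glue i j T p g), N - T)"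
        and i = "\<lambda>((j, f), S). ((f j, j, N - S), restrict_id f S, restrict f (N - S - {j}))"])
    fix z assume "z \<in> (SIGMA x:X. P x \<times> G x)"
    then obtain i j T p g where z: "z = ((i, j, T), p, g)"
      and ij: "i \<in> T" "j \<in> T" and T: "T \<subseteq> N" and p: "p permutes N - T"
      and g: "bij_betw g (T - {j}) (T - {i})" and ext: "g \<in> extensional (T - {j})"
      by (auto simp: X_def P_def G_def PiE_def)
    note gl = glue[OF ij T p g]
    have NT: "N - (N - T) = T" using T by blast
    have gj: "glue i j T p g j = i" by (simp add: glue_def)
    have rg: "restrict (glue i j T p g) (T - {j}) = g"
      using ext by (auto simp: glue_def fun_eq_iff restrict_def extensional_def)
    show "(\<lambda>((j, f), S). ((f j, j, N - S), restrict_id f S, restrict f (N - S - {j})))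
        ((\<lambda>((i, j, T), p, g). ((j, glue i j T p g), N - T)) z) = z"
      using gl rg by (simp add: z NT gj)
    show "(\<lambda>((i, j, T), p, g). ((j, glue i j T p g), N - T)) z \<in> Sigma Y I"
      using gl ij T by (auto simp: z Y_def I_def)
    have fT: "finite T" using T fin by (rule finite_subset)
    have "N - {j} = (N - T) \<union> (T - {j})" using T ij by blast
    then have "(\<Prod>u\<in>N - {j}. A $$ (u, glue i j T p g u)) =
        (\<Prod>u\<in>N - T. A $$ (u, glue i j T p g u)) * (\<Prod>u\<in>T - {j}. A $$ (u, glue i j T p g u))"
      using fin fT by (simp only:) (intro prod.union_disjoint, auto)
    also have "(\<Prod>u\<in>N - T. A $$ (u, glue i j T p g u)) = (\<Prod>u\<in>N - T. A $$ (u, p u))"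
      using ij by (intro prod.cong) (auto simp: glue_def)
    also have "(\<Prod>u\<in>T - {j}. A $$ (u, glue i j T p g u)) = (\<Prod>u\<in>T - {j}. A $$ (u, g u))"
      by (intro prod.cong) (auto simp: glue_def)
    finally have "(\<Prod>u\<in>N - {j}. A $$ (u, glue i j T p g u)) =
        (\<Prod>u\<in>N - T. A $$ (u, p u)) * (\<Prod>u\<in>T - {j}. A $$ (u, g u))" .
    moreover have "cycle_parity (glue i j T p g) (N - T) = (- 1) ^ card (N - T) * sign p"
      unfolding cycle_parity_def sign_on_def gl(3) ..
    ultimately show "V ((\<lambda>((i, j, T), p, g). ((j, glue i j T p g), N - T)) z) = W z"
      by (simp add: z V_def W_def ac_simps)
  next
    fix z assume "z \<in> Sigma Y I"
    then obtain j f S where z: "z = ((j, f), S)" and f: "f permutes N"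
      and S: "S \<subseteq> N" "f ` S = S" and j: "j \<in> N - S"
      by (auto simp: Y_def I_def)
    note ug = unglue[OF f S j]
    have NS: "N - (N - S) = S" using S by blast
    show "(\<lambda>((i, j, T), p, g). ((j, glue i j T p g), N - T))
        ((\<lambda>((j, f), S). ((f j, j, N - S), restrict_id f S, restrict f (N - S - {j}))) z) = z"
      using ug by (simp add: z NS)
    have "restrict f (N - S - {j}) \<in> (N - S - {j}) \<rightarrow>\<^sub>E (N - S - {f j})"
      using ug(2) by (auto simp: bij_betw_def)
    then show "(\<lambda>((j, f), S). ((f j, j, N - S), restrict_id f S, restrict f (N - S - {j}))) z
        \<in> (SIGMA x:X. P x \<times> G x)"
      using ug j by (auto simp: z X_def P_def G_def NS)
  qed
  also have "\<dots> = (\<Sum>y\<in>Y. \<Sum>S\<in>I y. V (y, S))"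
    by (subst sum.Sigma) (use finY finI in auto)
  also have "\<dots> = (\<Sum>(j, f) \<in> Y. A $$ (j, j) * (\<Prod>u\<in>N - {j}. A $$ (u, f u)) *
       of_int (\<Sum>S | S \<subseteq> N \<and> j \<notin> S \<and> f ` S = S. cycle_parity f S))"
    by (intro sum.cong refl) (auto simp: V_def I_def sum_distrib_left)
  finally show ?thesis unfolding X_def Y_def .
qed


section \<open>The formula\<close>

theorem mainTheorem2:
  fixes n :: nat and A :: "'a::comm_ring_1 mat"
  assumes "n \<ge> 1"
    and "A \<in> carrier_mat n n"
  shows "ham_path_polynomial n A =
    (\<Sum>(i, j, T) \<in> {(i, j, T). i \<in> {0..<n} \<and> j \<in> {0..<n} \<and> T \<subseteq> {0..<n} \<and> {i, j} \<subseteq> T}.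
       A $$ (j, j) * det (submatrix (- A) ({0..<n} - T) ({0..<n} - T))
         * submatrix_permanent A (T - {j}) (T - {i}))"
proof -
  let ?N = "{0..<n}"
  let ?m = "\<lambda>j f. A $$ (j, j) * (\<Prod>u\<in>?N - {j}. A $$ (u, f u))"
  have "(\<Sum>(j, f) \<in> ?N \<times> {f. f permutes ?N}.
       ?m j f * of_int (\<Sum>S | S \<subseteq> ?N \<and> j \<notin> S \<and> f ` S = S. cycle_parity f S)) =
      (\<Sum>(j, f) \<in> ?N \<times> {f. f permutes ?N}. if f \<in> full_cycles ?N then ?m j f else 0)"
    by (intro sum.cong refl) (auto simp: sum_cycle_parity_invariant_sets simp del: of_int_sum)
  also have "\<dots> = (\<Sum>(j, f) \<in> ?N \<times> full_cycles ?N. ?m j f)"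
  proof (rule sum.mono_neutral_cong_right)
    show "finite (?N \<times> {f. f permutes ?N})" by (simp add: finite_permutations)
    show "?N \<times> full_cycles ?N \<subseteq> ?N \<times> {f. f permutes ?N}"
      using full_cycles_permutes by blast
  qed (auto split: if_splits)
  also have "\<dots> = ham_path_polynomial n A"
    by (rule ham_path_polynomial_full_cycles[OF assms(1), symmetric])
  finally show ?thesis
    unfolding sum_det_per_expansion[OF assms(2)] by (rule sym)
qed

end
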